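(* Let $\{\mathsf{P}_\theta : \theta \in \mathbb{T}\}$ be a statistical model for data $X$ taking values in $\mathbb{X}$, and let $\tau_x : 2^{\mathbb{T}} \to [0,1]$, $x \in \mathbb{X}$, be a typicality measure, with $\tau_x(\theta) = \tau_x(\{\theta\})$, satisfying (i) $\tau_x(H) = \sup_{\theta \in H} \tau_x(\theta)$ for all $H \subseteq \mathbb{T}$ and all $x \in \mathbb{X}$; and (ii) $\sup_{\theta \in \mathbb{T}} \mathsf{P}_\theta\{\tau_X(\theta) \leq \alpha\} \leq \alpha$ for all $\alpha \in [0,1]$. For $x \in \mathbb{X}$ and $\alpha \in [0,1]$, define $$C_\alpha(x) = \{\theta \in \mathbb{T} : \tau_x(\theta) \geq \alpha\}.$$ Then $C_\alpha(x)$ is a nominal $100(1-\alpha)\%$ confidence set for $\Theta$ in the sense that $$\sup_{\theta \in \mathbb{T}} \mathsf{P}_\theta\{C_\alpha(X) \not\ni \theta\} \leq \alpha, \quad \text{for all } \alpha \in [0,1].$$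
   Context: The observable data $X$ takes values in a sample space $\mathbb{X}$. The statistical model $\{\mathsf{P}_\theta : \theta \in \mathbb{T}\}$ is a collection of probability distributions on $\mathbb{X}$ indexed by a parameter $\theta$ in a parameter space $\mathbb{T}$; $\Theta \in \mathbb{T}$ denotes the uncertain true value of the parameter. A hypothesis is a subset $H \subseteq \mathbb{T}$, identified with the assertion "$\Theta \in H$". The notation $\mathsf{P}_\theta\{\cdots X \cdots\}$ denotes the probability of the event in question when $X \sim \mathsf{P}_\theta$. A typicality measure assigns to each data value $x \in \mathbb{X}$ a set function $\tau_x : 2^{\mathbb{T}} \to [0,1]$, with $\tau_x(H)$ interpreted as the typicality of $x$ relative to the hypothesis $H$. One writes $\tau_x(\theta)$ for $\tau_x(\{\theta\})$. Suprema over the empty set of quantities in $[0,1]$ are taken to be $0$. *)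

theory Defs
  imports "HOL-Probability.Probability"
begin

text \<open>
  Supremum of a set of numbers in the unit interval. The library supremum of the empty
  set of reals is unspecified; here it is 0.
\<close>
definition sup01 :: "real set \<Rightarrow> real" where
  "sup01 A = (if A = {} then 0 else Sup A)"

definition statistical_model ::
    "'x measure \<Rightarrow> 'p set \<Rightarrow> ('p \<Rightarrow> 'x measure) \<Rightarrow> bool" where
  "statistical_model M T P \<longleftrightarrow> (\<forall>\<theta>\<in>T. prob_space (P \<theta>) \<and> sets (P \<theta>) = sets M)"

definition typicality_measure ::
    "'x measure \<Rightarrow> 'p set \<Rightarrow> ('x \<Rightarrow> 'p set \<Rightarrow> real) \<Rightarrow> bool" where
  "typicality_measure M T \<tau> \<longleftrightarrow> (\<forall>x\<in>space M. \<forall>H. H \<subseteq> T \<longrightarrow> \<tau> x H \<in> {0..1})"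

definition conf_set ::
    "'p set \<Rightarrow> ('x \<Rightarrow> 'p set \<Rightarrow> real) \<Rightarrow> real \<Rightarrow> 'x \<Rightarrow> 'p set" where
  "conf_set T \<tau> \<alpha> x = {\<theta> \<in> T. \<tau> x {\<theta>} \<ge> \<alpha>}"

end

theory Submission
  imports Defs
begin

text \<open>
  For a fixed parameter value, the confidence set misses it exactly when its typicality is
  strictly below the level. That event lies inside the event that the typicality is at most the
  level, whose probability is controlled by validity; monotonicity of probability therefore gives
  the bound parameter by parameter, and the bound is uniform, so it passes to the supremum.
  Two facts need attention. Monotonicity requires the larger event to be measurable, since the
  measure of a non-measurable set is 0; and passing between a bound on \<^const>\<open>sup01\<close> and
  a bound on each element requires the set of probabilities to be bounded above, and the level
  to be nonnegative in case the parameter space is empty.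
\<close>

lemma sup01_least:
  assumes "0 \<le> c" and "\<And>a. a \<in> A \<Longrightarrow> a \<le> c"
  shows "sup01 A \<le> c"
  using assms by (auto simp: sup01_def intro: cSup_least)

lemma sup01_upper:
  assumes "a \<in> A" and "bdd_above A"
  shows "a \<le> sup01 A"
  using assms by (auto simp: sup01_def intro: cSup_upper)

lemma not_in_conf_set_iff:
  assumes "\<theta> \<in> T"
  shows "\<theta> \<notin> conf_set T \<tau> \<alpha> x \<longleftrightarrow> \<tau> x {\<theta>} < \<alpha>"
  using assms by (auto simp: conf_set_def)

theorem proposition2:
  fixes M :: "'x measure"
    and T :: "'p set"
    and P :: "'p \<Rightarrow> 'x measure"
    and \<tau> :: "'x \<Rightarrow> 'p set \<Rightarrow> real"
  assumes model: "statistical_model M T P"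
    and typicality: "typicality_measure M T \<tau>"
    and meas: "\<And>\<theta>. \<theta> \<in> T \<Longrightarrow> (\<lambda>x. \<tau> x {\<theta>}) \<in> borel_measurable M"
    and sup_singletons: "\<And>H x. H \<subseteq> T \<Longrightarrow> x \<in> space M \<Longrightarrow> \<tau> x H = sup01 ((\<lambda>\<theta>. \<tau> x {\<theta>}) ` H)"
    and validity: "\<And>\<alpha>. \<alpha> \<in> {0..1} \<Longrightarrow>
               sup01 ((\<lambda>\<theta>. \<P>(x in P \<theta>. \<tau> x {\<theta>} \<le> \<alpha>)) ` T) \<le> \<alpha>"
  shows "\<forall>\<alpha>\<in>{0..1}. sup01 ((\<lambda>\<theta>. \<P>(x in P \<theta>. \<theta> \<notin> conf_set T \<tau> \<alpha> x)) ` T) \<le> \<alpha>"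
proof
  fix \<alpha> :: real
  assume \<alpha>: "\<alpha> \<in> {0..1}"
  define atypical where "atypical = (\<lambda>\<theta>. \<P>(x in P \<theta>. \<tau> x {\<theta>} \<le> \<alpha>))"
  have prob: "prob_space (P \<theta>)" and sets_P: "sets (P \<theta>) = sets M" if "\<theta> \<in> T" for \<theta>
    using model that by (auto simp: statistical_model_def)
  have bdd: "bdd_above (atypical ` T)"
    by (rule bdd_aboveI[where M = 1]) (auto simp: atypical_def intro: prob_space.prob_le_1 prob)
  have miss: "\<P>(x in P \<theta>. \<theta> \<notin> conf_set T \<tau> \<alpha> x) \<le> \<alpha>" if \<theta>: "\<theta> \<in> T" for \<theta>
  proof -
    interpret prob_space "P \<theta>" by (rule prob[OF \<theta>])
    have [measurable]: "(\<lambda>x. \<tau> x {\<theta>}) \<in> borel_measurable (P \<theta>)"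
      using meas[OF \<theta>] measurable_cong_sets[OF sets_P[OF \<theta>] refl] by blast
    have "\<P>(x in P \<theta>. \<theta> \<notin> conf_set T \<tau> \<alpha> x) \<le> atypical \<theta>"
      unfolding atypical_def
      by (rule finite_measure_mono) (auto simp: not_in_conf_set_iff[OF \<theta>])
    also have "\<dots> \<le> sup01 (atypical ` T)"
      using \<theta> bdd by (intro sup01_upper) auto
    also have "\<dots> \<le> \<alpha>"
      unfolding atypical_def by (rule validity[OF \<alpha>])
    finally show ?thesis .
  qed
  show "sup01 ((\<lambda>\<theta>. \<P>(x in P \<theta>. \<theta> \<notin> conf_set T \<tau> \<alpha> x)) ` T) \<le> \<alpha>"
    using \<alpha> miss by (intro sup01_least) auto
qed

end
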